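(* Let $\Sigma$ be an alphabet, let $F:\Sigma^{\mathbb{Z}}\to\Sigma^{\mathbb{Z}}$ be a rapidly left expansive cellular automaton, and let $x\in\mathcal{N}(\Sigma)$ be a number-like configuration. Then the sequence $(\operatorname{frac}(F^t(x)))_{t\in\mathbb{N}}$ has infinitely many limit points in $\Sigma^{\mathbb{N}}$.
   Context: $\mathbb{N}=\{0,1,2,\dots\}$ and $\mathbb{Z}_+=\{1,2,\dots\}$. An alphabet is a finite set $\Sigma=\{0,1,\dots,n-1\}$ with $n\in\mathbb{Z}_+$. Elements of $\Sigma^{\mathbb{Z}}$ are called configurations; $x[i]$ is the value of $x$ at $i$; $0^{\mathbb{Z}}$ is the all-zero configuration. For $x\in\Sigma^{\mathbb{Z}}$, $\operatorname{frac}(x)\in\Sigma^{\mathbb{N}}$ is defined by $\operatorname{frac}(x)[i]=x[i]$ for $i\in\mathbb{N}$. A sequence $(y_k)_{k\in\mathbb{N}}$ in $\Sigma^{\mathbb{N}}$ converges to $y\in\Sigma^{\mathbb{N}}$ if for every $n\in\mathbb{N}$ there is $N\in\mathbb{N}$ such that $y_k[i]=y[i]$ for all $0\le i\le n$ and all $k\ge N$. A point $y$ is a limit point of $(y_k)_{k\in\mathbb{N}}$ if some subsequence of $(y_k)_{k\in\mathbb{N}}$ converges to $y$. A map $F:\Sigma^{\mathbb{Z}}\to\Sigma^{\mathbb{Z}}$ is a cellular automaton (CA) if there are $m,n\in\mathbb{N}$ and $f:\Sigma^{m+n+1}\to\Sigma$ with $F(x)[i]=f(x[i-m],\dots,x[i],\dots,x[i+n])$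 for all $x\in\Sigma^{\mathbb{Z}}$, $i\in\mathbb{Z}$. A configuration $x\neq 0^{\mathbb{Z}}$ is number-like if there is $N\in\mathbb{Z}$ with $x[i]=0$ for all $i<N$; its left edge $\ell(x)$ is the least $N\in\mathbb{Z}$ with $x[N]\neq 0$. $\mathcal{N}(\Sigma)$ is the set of number-like configurations over $\Sigma$. The space-time diagram of $x\in\Sigma^{\mathbb{Z}}$ with respect to $F$ is $\theta\in\Sigma^{\mathbb{Z}\times(-\mathbb{N})}$, $\theta[(i,j)]=F^{-j}(x)[i]$ for $i\in\mathbb{Z}$, $j\le 0$. For $h,d\in\mathbb{N}$, $w\in\mathbb{Z}_+$ let $R(h,d,w)=\{(i,j)\in\mathbb{Z}^2\mid 0\le i<w,\ -d\le j\le h\}$. $F$ is left expansive with dimensions $(h,d,w)$ if, with $R=R(h,d,w)$, for all space-time diagrams $\theta_1,\theta_2$ with respect to $F$ and all $(i_1,j_1),(i_2,j_2)\in\mathbb{Z}^2$ with $(i_1,j_1)+R,\ (i_2,j_2)+R\subseteq\mathbb{Z}\times(-\mathbb{N})$: if $\theta_1[(i_1,j_1)+\rho]=\theta_2[(i_2,j_2)+\rho]$ for all $\rho\in R$, then $\theta_1[(i_1-1,j_1)]=\theta_2[(i_2-1,j_2)]$. $F$ is left spreading if $F(0^{\mathbb{Z}})=0^{\mathbb{Z}}$ and for each $x\in\mathcal{N}(\Sigma)$ there is $t\in\mathbb{Z}_+$ such that $\ell(F^t(x))<\ell(x)$ (in particular $F^t(x)\neq 0^{\mathbb{Z}}$).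 The spreading speed of a left spreading $F$ is $\sup_{x\in\mathcal{N}(\Sigma)}\limsup_{t\to\infty}\frac{-\ell(F^t(x))}{t}$. $F$ is rapidly left expansive if there are $h,d\in\mathbb{N}$ and $w\in\mathbb{Z}_+$ such that $F$ is left expansive with dimensions $(h,d,w)$, $F$ is left spreading with spreading speed $s$, and $s<1/h$ (with the convention $1/0=\infty$). *)

theory Defs
  imports "HOL-Library.Extended_Real" "HOL-Library.FuncSet" "HOL-Library.Product_Plus"
begin

abbreviation alphabet :: "nat \<Rightarrow> nat set" where
  "alphabet n \<equiv> {0..<n}"

abbreviation configurations :: "nat \<Rightarrow> (int \<Rightarrow> nat) set" where
  "configurations n \<equiv> UNIV \<rightarrow> alphabet n"

abbreviation right_infinite_words :: "nat \<Rightarrow> (nat \<Rightarrow> nat) set" where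
  "right_infinite_words n \<equiv> UNIV \<rightarrow> alphabet n"

definition zero_conf :: "int \<Rightarrow> nat" where
  "zero_conf = (\<lambda>i. 0)"

text \<open>Not to be confused with the library's \<^const>\<open>frac\<close>, the fractional part of a number.\<close>

definition frac_conf :: "(int \<Rightarrow> nat) \<Rightarrow> nat \<Rightarrow> nat" where
  "frac_conf x = (\<lambda>i. x (int i))"

definition seq_converges :: "(nat \<Rightarrow> nat \<Rightarrow> nat) \<Rightarrow> (nat \<Rightarrow> nat) \<Rightarrow> bool" where
  "seq_converges Y y \<longleftrightarrow> (\<forall>m. \<exists>N. \<forall>k\<ge>N. \<forall>i\<le>m. Y k i = y i)"

definition limit_point :: "(nat \<Rightarrow> nat \<Rightarrow> nat) \<Rightarrow> (nat \<Rightarrow> nat) \<Rightarrow> bool" where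
  "limit_point Y y \<longleftrightarrow> (\<exists>r. strict_mono r \<and> seq_converges (Y \<circ> r) y)"

text \<open>A word over the alphabet of length \<open>a + b + 1\<close> is a list. The values of \<open>F\<close> outside
  \<^term>\<open>configurations n\<close> are unconstrained and never used.\<close>

definition cellular_automaton :: "nat \<Rightarrow> ((int \<Rightarrow> nat) \<Rightarrow> int \<Rightarrow> nat) \<Rightarrow> bool" where
  "cellular_automaton n F \<longleftrightarrow>
     (\<exists>a b :: nat. \<exists>f :: nat list \<Rightarrow> nat.
        (\<forall>u. length u = a + b + 1 \<and> set u \<subseteq> alphabet n \<longrightarrow> f u \<in> alphabet n) \<and>
        (\<forall>x\<in>configurations n. \<forall>i. F x i = f (map x [i - int a..i + int b])))"

definition number_like :: "nat \<Rightarrow> (int \<Rightarrow> nat) set" where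
  "number_like n = {x \<in> configurations n. x \<noteq> zero_conf \<and> (\<exists>N. \<forall>i<N. x i = 0)}"

definition left_edge :: "(int \<Rightarrow> nat) \<Rightarrow> int" where
  "left_edge x = (LEAST N. x N \<noteq> 0)"

text \<open>Only the values at points \<open>(i, j)\<close> with \<open>j \<le> 0\<close> are meaningful: time runs downwards.\<close>

definition space_time_diagram ::
  "((int \<Rightarrow> nat) \<Rightarrow> int \<Rightarrow> nat) \<Rightarrow> (int \<Rightarrow> nat) \<Rightarrow> int \<times> int \<Rightarrow> nat" where
  "space_time_diagram F x = (\<lambda>(i, j). (F ^^ nat (- j)) x i)"

definition rectangle :: "nat \<Rightarrow> nat \<Rightarrow> nat \<Rightarrow> (int \<times> int) set" where
  "rectangle h d w = {(i, j). 0 \<le> i \<and> i < int w \<and> - int d \<le> j \<and> j \<le> int h}"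

definition left_expansive ::
  "nat \<Rightarrow> ((int \<Rightarrow> nat) \<Rightarrow> int \<Rightarrow> nat) \<Rightarrow> nat \<Rightarrow> nat \<Rightarrow> nat \<Rightarrow> bool" where
  "left_expansive n F h d w \<longleftrightarrow>
     (\<forall>x1\<in>configurations n. \<forall>x2\<in>configurations n. \<forall>i1 j1 i2 j2.
        let R = rectangle h d w;
            \<theta>1 = space_time_diagram F x1;
            \<theta>2 = space_time_diagram F x2
        in (+) (i1, j1) ` R \<subseteq> UNIV \<times> {..0} \<and> (+) (i2, j2) ` R \<subseteq> UNIV \<times> {..0} \<and>
           (\<forall>\<rho>\<in>R. \<theta>1 ((i1, j1) + \<rho>) = \<theta>2 ((i2, j2) + \<rho>)) \<longrightarrow>
           \<theta>1 (i1 - 1, j1) = \<theta>2 (i2 - 1, j2))"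

text \<open>The condition \<open>(F ^^ t) x \<noteq> zero_conf\<close> is stated explicitly because \<^const>\<open>left_edge\<close> is
  total and has an unspecified value on \<^const>\<open>zero_conf\<close>.\<close>

definition left_spreading :: "nat \<Rightarrow> ((int \<Rightarrow> nat) \<Rightarrow> int \<Rightarrow> nat) \<Rightarrow> bool" where
  "left_spreading n F \<longleftrightarrow>
     F zero_conf = zero_conf \<and>
     (\<forall>x\<in>number_like n. \<exists>t\<ge>1.
        (F ^^ t) x \<noteq> zero_conf \<and> left_edge ((F ^^ t) x) < left_edge x)"

definition spreading_speed :: "nat \<Rightarrow> ((int \<Rightarrow> nat) \<Rightarrow> int \<Rightarrow> nat) \<Rightarrow> ereal" where
  "spreading_speed n F =
     (SUP x\<in>number_like n.
        limsup (\<lambda>t. ereal (- real_of_int (left_edge ((F ^^ t) x)) / real t)))"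

text \<open>Division in \<^typ>\<open>ereal\<close> satisfies \<open>1 / 0 = \<infinity>\<close>, which is the convention needed for \<open>h = 0\<close>.\<close>

definition rapidly_left_expansive :: "nat \<Rightarrow> ((int \<Rightarrow> nat) \<Rightarrow> int \<Rightarrow> nat) \<Rightarrow> bool" where
  "rapidly_left_expansive n F \<longleftrightarrow>
     (\<exists>h d w. w \<ge> 1 \<and> left_expansive n F h d w \<and> left_spreading n F \<and>
        spreading_speed n F < 1 / ereal (real h))"

end

theory Submission
  imports Defs "HOL-Library.Diagonal_Subsequence"
begin

text \<open>
  Write \<open>X t\<close> for the row \<open>(F ^^ t) x\<close> and suppose that \<open>t \<mapsto> frac_conf (X t)\<close> has only finitely
  many limit points. The contradiction comes from the behaviour of vertical strips in time.

  \<^emph>\<open>Some strip is periodic in time.\<close> By compactness, the late rows agree on any prescribed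
  prefix with one of the finitely many limit points. The prefix of a row does not determine the
  prefix of its successor, because information also enters from the left. It does determine a
  slightly shorter piece of the successor that starts at column \<open>a\<close>, the left radius of \<open>F\<close>. Far enough to the right
  this loss is harmless: finitely many words have only finitely many tails to tell apart, so for a
  suitable column \<open>K\<close> two limit points that agree from \<open>K + a\<close> on already agree from \<open>K\<close> on
  (\<open>finite_set_tails_determined\<close>). Hence the class of the shadowing limit point modulo agreement
  on \<open>{K..}\<close> evolves deterministically through finitely many values, and is eventually periodic
  (\<open>orbit_window_eventually_periodic\<close>).

  \<^emph>\<open>The periodicity moves left faster than the support does.\<close> Left expansivity determines a cell
  from a window to its right that reaches \<open>h\<close> steps into the past, so each further column to the
  left becomes periodic at most \<open>h\<close> steps later (\<open>periodicity_spreads_left\<close>): column \<open>K - j\<close> is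
  periodic from time \<open>T + j * h\<close> on. As the spreading speed is less than \<open>1 / h\<close>, for large \<open>j\<close> the
  left edge has not reached column \<open>K - j\<close> even one period after that time. The column is then zero
  during a full period and remains zero forever, although the left edge of a left spreading
  automaton eventually passes every column (\<open>periodic_window_contradicts_spreading\<close>).
\<close>

section \<open>Compactness of the space of right-infinite words\<close>

abbreviation agree_on :: "'i set \<Rightarrow> ('i \<Rightarrow> 'v) \<Rightarrow> ('i \<Rightarrow> 'v) \<Rightarrow> bool" where
  "agree_on A u v \<equiv> \<forall>i\<in>A. u i = v i"

text \<open>The diagonal argument: pass successively to subsequences along which the letter at
  position \<open>m\<close> is constant, which is possible since the alphabet is finite.\<close>

lemma word_sequence_has_limit_point:
  assumes "\<And>t. Y t \<in> right_infinite_words n"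
  obtains y where "limit_point Y y"
proof -
  define P where "P = (\<lambda>m (r :: nat \<Rightarrow> nat). \<exists>v. \<forall>k. Y (r k) m = v)"
  have P_subseq: "\<exists>r'. strict_mono r' \<and> P m (r \<circ> r')" if "strict_mono r" for m and r :: "nat \<Rightarrow> nat"
  proof -
    have "finite (range (\<lambda>k. Y (r k) m))"
      by (rule finite_subset[of _ "alphabet n"]) (use assms in auto)
    then obtain k0 where "infinite {k. Y (r k) m = Y (r k0) m}"
      using pigeonhole_infinite[of UNIV "\<lambda>k. Y (r k) m", OF infinite_UNIV_nat] by auto
    then have "P m (r \<circ> enumerate {k. Y (r k) m = Y (r k0) m})"
      using enumerate_in_set[of "{k. Y (r k) m = Y (r k0) m}"] by (auto simp: P_def)
    with \<open>infinite _\<close> show ?thesis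
      using strict_mono_enumerate by blast
  qed
  then interpret subseqs P
    by unfold_locales blast
  have "P m (diagseq \<circ> (+) (Suc m))" for m
    by (rule diagseq_holds) (auto simp: P_def)
  then obtain y where y: "\<And>m l. Y (diagseq (Suc m + l)) m = y m"
    unfolding P_def o_def by metis
  have "Y (diagseq k) i = y i" if "Suc m \<le> k" "i \<le> m" for m k i
    using y[of i "k - Suc i"] that by simp
  then have "seq_converges (Y \<circ> diagseq) y"
    unfolding seq_converges_def o_def by blast
  then show thesis
    using that subseq_diagseq unfolding limit_point_def by blast
qed

lemma limit_point_in_words:
  assumes "\<And>t. Y t \<in> right_infinite_words n" "limit_point Y y"
  shows "y \<in> right_infinite_words n"
proof (rule funcsetI)
  fix i :: nat
  obtain r :: "nat \<Rightarrow> nat" and N where "\<forall>k\<ge>N. \<forall>j\<le>i. (Y \<circ> r) k j = y j"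
    using assms(2) unfolding limit_point_def seq_converges_def by blast
  then have "y i = Y (r N) i" by auto
  then show "y i \<in> alphabet n" using assms(1)[of "r N"] by auto
qed

lemma limit_point_of_subsequence:
  assumes "strict_mono r" "limit_point (Y \<circ> r) y"
  shows "limit_point Y y"
  using assms unfolding limit_point_def
  by (metis comp_assoc strict_mono_o)

text \<open>Otherwise infinitely many members of the sequence differ on \<open>{..m}\<close> from every limit point.
  They form a subsequence, which by compactness has a limit point of its own; but that limit point
  agrees on \<open>{..m}\<close> with some of them.\<close>

lemma eventually_shadowed_by_limit_points:
  assumes words: "\<And>t. Y t \<in> right_infinite_words n"
  shows "\<exists>T. \<forall>t\<ge>T. \<exists>y. limit_point Y y \<and> agree_on {..m} (Y t) y"
proof (rule ccontr)
  define B where "B = {t. \<not> (\<exists>y. limit_point Y y \<and> agree_on {..m} (Y t) y)}"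
  assume "\<not> ?thesis"
  then have "\<forall>T. \<exists>t\<ge>T. t \<in> B"
    unfolding B_def mem_Collect_eq by simp
  then have "infinite B"
    unfolding infinite_nat_iff_unbounded_le .
  then have mono: "strict_mono (enumerate B)" and inB: "\<And>k. enumerate B k \<in> B"
    by (auto intro: strict_mono_enumerate enumerate_in_set)
  obtain y where y: "limit_point (Y \<circ> enumerate B) y"
    using word_sequence_has_limit_point[of "Y \<circ> enumerate B" n] words by auto
  obtain r :: "nat \<Rightarrow> nat" and N where "\<forall>k\<ge>N. \<forall>i\<le>m. (Y \<circ> enumerate B \<circ> r) k i = y i"
    using y unfolding limit_point_def seq_converges_def by blast
  then have "agree_on {..m} (Y (enumerate B (r N))) y" by auto
  moreover have "limit_point Y y"
    using limit_point_of_subsequence[OF mono y] .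
  ultimately show False
    using inB[of "r N"] by (auto simp: B_def)
qed

text \<open>Only finitely many pairs of words are involved. If the two words of a pair agree
  eventually, they agree from \<open>K\<close> on as soon as \<open>K\<close> is large. If they do not, they differ beyond
  \<open>K + a\<close>, and any large \<open>L\<close> has such a difference to its left. The gap \<open>a\<close> is there to absorb the
  left radius of an automaton.\<close>

lemma finite_set_tails_determined:
  fixes Y :: "(nat \<Rightarrow> 'v) set"
  assumes "finite Y"
  shows "\<exists>K. \<forall>\<^sub>F L in sequentially. \<forall>y\<in>Y. \<forall>z\<in>Y.
           agree_on {K + a..L} y z \<longrightarrow> agree_on {K..} y z"
proof -
  have "\<forall>\<^sub>F K in sequentially. \<forall>p\<in>Y \<times> Y.
          (\<exists>k. agree_on {k..} (fst p) (snd p)) \<longrightarrow> agree_on {K..} (fst p) (snd p)"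
    using assms
  proof (intro eventually_ball_finite ballI finite_cartesian_product)
    fix p :: "(nat \<Rightarrow> 'v) \<times> (nat \<Rightarrow> 'v)"
    show "\<forall>\<^sub>F K in sequentially.
        (\<exists>k. agree_on {k..} (fst p) (snd p)) \<longrightarrow> agree_on {K..} (fst p) (snd p)"
    proof (cases "\<exists>k. agree_on {k..} (fst p) (snd p)")
      case True
      then obtain k where "agree_on {k..} (fst p) (snd p)" by blast
      then show ?thesis
        by (intro eventually_sequentiallyI[of k]) auto
    next
      case False
      then show ?thesis
        by (intro always_eventually) blast
    qed
  qed
  then obtain K where "\<forall>p\<in>Y \<times> Y.
      (\<exists>k. agree_on {k..} (fst p) (snd p)) \<longrightarrow> agree_on {K..} (fst p) (snd p)"
    using eventually_happens'[OF sequentially_bot] by blast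
  then have K: "agree_on {K..} y z" if "y \<in> Y" "z \<in> Y" "agree_on {k..} y z" for y z k
    using that by (metis SigmaI fst_conv snd_conv)
  have "\<forall>\<^sub>F L in sequentially. \<forall>p\<in>Y \<times> Y.
          agree_on {K + a..L} (fst p) (snd p) \<longrightarrow> agree_on {K..} (fst p) (snd p)"
    using assms
  proof (intro eventually_ball_finite ballI finite_cartesian_product)
    fix p assume p: "p \<in> Y \<times> Y"
    show "\<forall>\<^sub>F L in sequentially.
        agree_on {K + a..L} (fst p) (snd p) \<longrightarrow> agree_on {K..} (fst p) (snd p)"
    proof (cases "agree_on {K + a..} (fst p) (snd p)")
      case True
      then have "agree_on {K..} (fst p) (snd p)"
        using p K[of "fst p" "snd p" "K + a"] by (auto simp: mem_Times_iff)
      then show ?thesis by simp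
    next
      case False
      then obtain i where "i \<ge> K + a" "fst p i \<noteq> snd p i" by auto
      then show ?thesis
        by (intro eventually_sequentiallyI[of i]) auto
    qed
  qed
  then show ?thesis
    by (intro exI[of _ K]) (auto elim!: eventually_mono)
qed

section \<open>A strip of the orbit that is periodic in time\<close>

lemma cellular_automaton_local:
  assumes "cellular_automaton n F"
  obtains a b :: nat where
    "\<And>u v i. u \<in> configurations n \<Longrightarrow> v \<in> configurations n \<Longrightarrow>
       agree_on {i - int a..i + int b} u v \<Longrightarrow> F u i = F v i"
proof -
  obtain a b f where f: "\<And>u i. u \<in> configurations n \<Longrightarrow> F u i = f (map u [i - int a..i + int b])"
    using assms unfolding cellular_automaton_def by blast
  show thesis
  proof (rule that[of a b])
    fix u v i assume "u \<in> configurations n" "v \<in> configurations n"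
      and "agree_on {i - int a..i + int b} u v"
    then show "F u i = F v i"
      using f[of u i] f[of v i] by (metis (no_types, lifting) map_cong set_upto)
  qed
qed

lemma orbit_in_configurations:
  assumes "cellular_automaton n F" "u \<in> configurations n"
  shows "(F ^^ t) u \<in> configurations n"
proof (induction t)
  case (Suc t)
  obtain a b f where f: "\<And>u. length u = a + b + 1 \<Longrightarrow> set u \<subseteq> alphabet n \<Longrightarrow> f u \<in> alphabet n"
    "\<And>u i. u \<in> configurations n \<Longrightarrow> F u i = f (map u [i - int a..i + int b])"
    using assms(1) unfolding cellular_automaton_def by blast
  show ?case
  proof (rule funcsetI)
    fix i
    have "f (map ((F ^^ t) u) [i - int a..i + int b]) \<in> alphabet n"
      using Suc by (intro f(1)) auto
    then show "(F ^^ Suc t) u i \<in> alphabet n"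
      using f(2)[OF Suc, of i] by simp
  qed
qed (use assms in simp)

text \<open>Every late row is shadowed on \<open>{..L + b}\<close> by some limit point \<open>c t\<close>. When \<open>c s\<close> and \<open>c t\<close> agree
  on \<open>{K..}\<close>, so do the rows \<open>s\<close> and \<open>t\<close> on \<open>{K..L + b}\<close>, hence their successors on \<open>{K + a..L}\<close>, and
  by the choice of \<open>K\<close> and \<open>L\<close> this is enough for \<open>c (Suc s)\<close> and \<open>c (Suc t)\<close> to agree on \<open>{K..}\<close>
  again. One repetition \<open>c t0 = c (t0 + P)\<close>, which the pigeonhole principle provides, is therefore
  inherited by all later times.\<close>

lemma orbit_window_eventually_periodic:
  assumes ca: "cellular_automaton n F" and x: "x \<in> configurations n"
    and fin: "finite {y. limit_point (\<lambda>t. frac_conf ((F ^^ t) x)) y}"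
  obtains K T P :: nat where "P > 0"
    "\<And>t. t \<ge> T \<Longrightarrow> agree_on {int K..<int K + int w} ((F ^^ (t + P)) x) ((F ^^ t) x)"
proof -
  let ?X = "\<lambda>t. (F ^^ t) x"
  define Y where "Y = {y. limit_point (\<lambda>t. frac_conf (?X t)) y}"
  have X: "?X t \<in> configurations n" for t
    using orbit_in_configurations[OF ca x] .
  obtain a b where loc: "\<And>u v i. u \<in> configurations n \<Longrightarrow> v \<in> configurations n \<Longrightarrow>
       agree_on {i - int a..i + int b} u v \<Longrightarrow> F u i = F v i"
    by (rule cellular_automaton_local[OF ca]) blast
  obtain K where "\<forall>\<^sub>F L in sequentially. \<forall>y\<in>Y. \<forall>z\<in>Y.
           agree_on {K + a..L} y z \<longrightarrow> agree_on {K..} y z"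
    using finite_set_tails_determined fin unfolding Y_def by blast
  then have "\<forall>\<^sub>F L in sequentially. L \<ge> K + w \<and> (\<forall>y\<in>Y. \<forall>z\<in>Y.
           agree_on {K + a..L} y z \<longrightarrow> agree_on {K..} y z)"
    by (intro eventually_conj eventually_ge_at_top)
  then obtain L where L: "L \<ge> K + w"
    "\<And>y z. y \<in> Y \<Longrightarrow> z \<in> Y \<Longrightarrow> agree_on {K + a..L} y z \<Longrightarrow> agree_on {K..} y z"
    unfolding eventually_sequentially by blast
  have "frac_conf (?X t) \<in> right_infinite_words n" for t
    using X[of t] by (auto simp: frac_conf_def)
  from eventually_shadowed_by_limit_points[of "\<lambda>t. frac_conf (?X t)", OF this, of "L + b"]
  obtain T where "\<forall>t\<ge>T. \<exists>y\<in>Y. agree_on {..L + b} (frac_conf (?X t)) y"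
    by (auto simp: Y_def)
  then obtain c where c: "\<And>t. t \<ge> T \<Longrightarrow> c t \<in> Y"
    and cX: "\<And>t i. t \<ge> T \<Longrightarrow> i \<le> L + b \<Longrightarrow> ?X t (int i) = c t i"
    by (metis atMost_iff frac_conf_def)
  have rows: "agree_on {int K..int (L + b)} (?X s) (?X t)"
    if "s \<ge> T" "t \<ge> T" "agree_on {K..} (c s) (c t)" for s t
  proof
    fix i assume i: "i \<in> {int K..int (L + b)}"
    then have "i = int (nat i)" "nat i \<le> L + b" "nat i \<ge> K" by auto
    then show "?X s i = ?X t i"
      using cX[OF that(1), of "nat i"] cX[OF that(2), of "nat i"] that(3) by auto
  qed
  have succ: "agree_on {K..} (c (Suc s)) (c (Suc t))"
    if "s \<ge> T" "t \<ge> T" "agree_on {K..} (c s) (c t)" for s t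
  proof (rule L(2))
    show "agree_on {K + a..L} (c (Suc s)) (c (Suc t))"
    proof
      fix i assume i: "i \<in> {K + a..L}"
      have "F (?X s) (int i) = F (?X t) (int i)"
        using rows[OF that] i by (intro loc X) auto
      then show "c (Suc s) i = c (Suc t) i"
        using i cX[of "Suc s" i] cX[of "Suc t" i] that(1,2) by auto
    qed
  qed (use c that(1,2) in auto)
  have "\<not> inj_on c {T..}"
  proof
    assume "inj_on c {T..}"
    moreover have "finite (c ` {T..})"
      using fin c by (auto intro: finite_subset[of _ Y] simp: Y_def[symmetric])
    ultimately show False
      using finite_imageD infinite_Ici by blast
  qed
  then obtain t0 t1 where "t0 \<ge> T" "t0 < t1" "c t0 = c t1"
    unfolding inj_on_def by (metis atLeast_iff linorder_neqE_nat)
  then obtain P where P: "P > 0" "c (t0 + P) = c t0"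
    by (metis less_imp_add_positive)
  have per: "agree_on {K..} (c (t + P)) (c t)" if "t \<ge> t0" for t
    using that
  proof (induction t rule: dec_induct)
    case (step t)
    then show ?case
      using succ[of "t + P" t] \<open>t0 \<ge> T\<close> by simp
  qed (use P in simp)
  show thesis
  proof (rule that[OF P(1)])
    fix t assume "t \<ge> t0"
    then show "agree_on {int K..<int K + int w} (?X (t + P)) (?X t)"
      using rows[OF _ _ per[of t]] \<open>t0 \<ge> T\<close> L(1) by auto
  qed
qed

section \<open>Left expansivity carries the period to the left\<close>

text \<open>Left expansivity for two places in the same diagram and the same column. In a space-time
  diagram time runs downwards, so the rows of the rectangle at height \<open>- int t\<close> are the times from
  \<open>t - h\<close> to \<open>t + d\<close>; the index \<open>k\<close> counts them starting from the earliest.\<close>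

lemma left_expansive_column:
  assumes exp: "left_expansive n F h d w" and x: "x \<in> configurations n"
    and st: "h \<le> s" "h \<le> t"
    and eq: "\<And>k. k \<le> h + d \<Longrightarrow>
      agree_on {i..<i + int w} ((F ^^ (s - h + k)) x) ((F ^^ (t - h + k)) x)"
  shows "(F ^^ s) x (i - 1) = (F ^^ t) x (i - 1)"
proof -
  let ?D = "space_time_diagram F x" and ?R = "rectangle h d w"
  have sub: "(+) (i, - int r) ` ?R \<subseteq> UNIV \<times> {..0}" if "h \<le> r" for r
    using that by (auto simp: rectangle_def)
  have cells: "?D ((i, - int s) + \<rho>) = ?D ((i, - int t) + \<rho>)" if "\<rho> \<in> ?R" for \<rho>
  proof -
    obtain p q where [simp]: "\<rho> = (p, q)" by fastforce
    have pq: "0 \<le> p" "p < int w" "- int d \<le> q" "q \<le> int h"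
      using that by (auto simp: rectangle_def)
    define k where "k = nat (int h - q)"
    have k: "k \<le> h + d" using pq by (auto simp: k_def)
    have "nat (int s - q) = s - h + k" "nat (int t - q) = t - h + k"
      using st pq by (auto simp: k_def)
    then show ?thesis
      using eq[OF k] pq by (auto simp: space_time_diagram_def)
  qed
  have "?D (i - 1, - int s) = ?D (i - 1, - int t)"
    by (rule exp[unfolded left_expansive_def Let_def, rule_format, OF x x])
      (intro conjI ballI sub st cells)
  then show ?thesis
    by (simp add: space_time_diagram_def)
qed

text \<open>The window that determines the next column at time \<open>t\<close> begins at time \<open>t - h\<close>, which costs
  a delay of \<open>h\<close> per column. It also reaches \<open>d\<close> steps into the future, but that costs nothing,
  since periodicity holds at all late times.\<close>

lemma periodicity_spreads_left:
  assumes exp: "left_expansive n F h d w" and x: "x \<in> configurations n"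
    and per: "\<And>t. t \<ge> T \<Longrightarrow> agree_on {K..<K + int w} ((F ^^ (t + P)) x) ((F ^^ t) x)"
    and t: "t \<ge> T + j * h"
  shows "agree_on {K - int j..<K + int w} ((F ^^ (t + P)) x) ((F ^^ t) x)"
  using t
proof (induction j arbitrary: t)
  case 0
  then show ?case using per by simp
next
  case (Suc j)
  have t: "t \<ge> T + j * h" "h \<le> t" "T + j * h \<le> t - h"
    using Suc.prems by auto
  have new: "(F ^^ (t + P)) x (K - int j - 1) = (F ^^ t) x (K - int j - 1)"
  proof (rule left_expansive_column[OF exp x])
    fix k
    have "T + j * h \<le> t - h + k" using t by simp
    moreover have "t + P - h + k = t - h + k + P" using t by simp
    ultimately show "agree_on {K - int j..<K - int j + int w}
        ((F ^^ (t + P - h + k)) x) ((F ^^ (t - h + k)) x)"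
      using Suc.IH[of "t - h + k"] by (simp only: ball_simps) auto
  qed (use t in auto)
  have "i = K - int j - 1 \<or> i \<in> {K - int j..<K + int w}"
    if "i \<in> {K - int (Suc j)..<K + int w}" for i
    using that by auto
  then show ?case
    using new Suc.IH[OF t(1)] by blast
qed

section \<open>Motion of the left edge\<close>

text \<open>The integers are not well-ordered, so the least nonzero position is first found among the
  natural offsets from a lower bound \<open>N\<close> of the support.\<close>

lemma left_edge_least:
  assumes "u \<in> number_like n"
  shows "u (left_edge u) \<noteq> 0" "\<And>i. u i \<noteq> 0 \<Longrightarrow> left_edge u \<le> i"
proof -
  obtain N where N: "\<forall>i<N. u i = 0" and "u \<noteq> zero_conf"
    using assms by (auto simp: number_like_def)
  then obtain i0 where i0: "u i0 \<noteq> 0" by (auto simp: zero_conf_def)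
  define m where "m = (LEAST k. u (N + int k) \<noteq> 0)"
  have shift: "i = N + int (nat (i - N))" if "u i \<noteq> 0" for i
    using N that by (metis diff_ge_0_iff_ge add.commute diff_add_cancel linorder_not_less nat_0_le)
  have m: "u (N + int m) \<noteq> 0"
    unfolding m_def by (rule LeastI[of _ "nat (i0 - N)"]) (use i0 shift in metis)
  have min: "N + int m \<le> i" if "u i \<noteq> 0" for i
  proof -
    have "m \<le> nat (i - N)"
      unfolding m_def by (rule Least_le) (use that shift in metis)
    then show ?thesis using shift[OF that] by linarith
  qed
  have "left_edge u = N + int m"
    unfolding left_edge_def using m min by (rule Least_equality)
  with m min show "u (left_edge u) \<noteq> 0" "\<And>i. u i \<noteq> 0 \<Longrightarrow> left_edge u \<le> i"
    by auto
qed

lemma funpow_zero_conf: "F zero_conf = zero_conf \<Longrightarrow> (F ^^ t) zero_conf = zero_conf"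
  by (induction t) auto

text \<open>If \<open>F u\<close> were zero then the whole future of \<open>u\<close> would be zero, whereas left spreading
  provides a later time at which it is not.\<close>

lemma number_like_step:
  assumes ca: "cellular_automaton n F" and spread: "left_spreading n F"
    and u: "u \<in> number_like n"
  shows "F u \<in> number_like n"
proof -
  have F0: "F zero_conf = zero_conf"
    using spread by (simp add: left_spreading_def)
  have uc: "u \<in> configurations n"
    using u by (simp add: number_like_def)
  have zc: "zero_conf \<in> configurations n"
    using uc by (auto simp: zero_conf_def Pi_iff)
  obtain a b where loc: "\<And>u v i. u \<in> configurations n \<Longrightarrow> v \<in> configurations n \<Longrightarrow>
       agree_on {i - int a..i + int b} u v \<Longrightarrow> F u i = F v i"
    by (rule cellular_automaton_local[OF ca]) blast
  obtain N where N: "\<forall>i<N. u i = 0"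
    using u by (auto simp: number_like_def)
  have "F u i = 0" if "i < N - int b" for i
  proof -
    have "F u i = F zero_conf i"
      using N that by (intro loc uc zc) (auto simp: zero_conf_def)
    then show ?thesis using F0 by (simp add: zero_conf_def)
  qed
  moreover have "F u \<noteq> zero_conf"
  proof
    assume "F u = zero_conf"
    then have "(F ^^ t) u = zero_conf" if "t \<ge> 1" for t
      using that funpow_zero_conf[of F, OF F0] by (cases t) (auto simp: funpow_swap1)
    then show False
      using spread u unfolding left_spreading_def by blast
  qed
  moreover have "F u \<in> configurations n"
    using orbit_in_configurations[OF ca uc, of 1] by simp
  ultimately show ?thesis
    unfolding number_like_def by blast
qed

lemma orbit_number_like:
  assumes "cellular_automaton n F" "left_spreading n F" "u \<in> number_like n"
  shows "(F ^^ t) u \<in> number_like n"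
  by (induction t) (use assms number_like_step in auto)

lemma left_edge_unbounded:
  assumes ca: "cellular_automaton n F" and spread: "left_spreading n F"
    and u: "u \<in> number_like n"
  shows "\<exists>t. left_edge ((F ^^ t) u) < B"
proof -
  have "\<exists>t. left_edge ((F ^^ t) u) \<le> left_edge u - int k" for k
  proof (induction k)
    case 0
    show ?case by (intro exI[of _ 0]) simp
  next
    case (Suc k)
    then obtain t where t: "left_edge ((F ^^ t) u) \<le> left_edge u - int k" by blast
    obtain t' where "left_edge ((F ^^ t') ((F ^^ t) u)) < left_edge ((F ^^ t) u)"
      using spread orbit_number_like[OF assms] unfolding left_spreading_def by blast
    then show ?case
      using t by (intro exI[of _ "t' + t"]) (simp add: funpow_add)
  qed
  from this[of "nat (left_edge u - B + 1)"] obtain t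
    where "left_edge ((F ^^ t) u) \<le> left_edge u - int (nat (left_edge u - B + 1))" by blast
  then show ?thesis by (intro exI[of _ t]) linarith
qed

text \<open>The slope \<open>q\<close> is a real number strictly between the spreading speed and \<open>1 / h\<close>, raised to \<open>0\<close>
  if negative. Stating the upper bound as \<open>q * real h < 1\<close> covers \<open>h = 0\<close> as well.\<close>

lemma left_edge_eventually_above_line:
  assumes speed: "spreading_speed n F < 1 / ereal (real h)" and u: "u \<in> number_like n"
  obtains q :: real and N where "q \<ge> 0" "q * real h < 1"
    "\<And>t. t \<ge> N \<Longrightarrow> - q * real t \<le> real_of_int (left_edge ((F ^^ t) u))"
proof -
  let ?r = "\<lambda>t. ereal (- real_of_int (left_edge ((F ^^ t) u)) / real t)"
  obtain z where z: "spreading_speed n F < ereal z" "ereal z < 1 / ereal (real h)"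
    using ereal_dense2[OF speed] by blast
  have "limsup ?r \<le> spreading_speed n F"
    unfolding spreading_speed_def by (intro SUP_upper u)
  then have "limsup ?r < ereal z" using z(1) by simp
  then have "\<forall>\<^sub>F t in sequentially. ?r t < ereal z"
    by (rule Limsup_lessD)
  then obtain N where N: "\<And>t. t \<ge> N \<Longrightarrow> ?r t < ereal z"
    unfolding eventually_sequentially by blast
  show thesis
  proof (rule that[of "max z 0" "Suc N"])
    show "max z 0 * real h < 1"
    proof (cases "h = 0")
      case False
      then have "z < 1 / real h" using z(2) by (simp add: one_ereal_def)
      with False show ?thesis by (auto simp: max_def field_simps)
    qed simp
    fix t assume "t \<ge> Suc N"
    then have "t > 0" and "- real_of_int (left_edge ((F ^^ t) u)) / real t < z"
      using N[of t] by auto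
    then have "- real_of_int (left_edge ((F ^^ t) u)) < z * real t"
      by (simp add: field_simps)
    also have "\<dots> \<le> max z 0 * real t" by (intro mult_right_mono) auto
    finally show "- max z 0 * real t \<le> real_of_int (left_edge ((F ^^ t) u))" by simp
  qed simp
qed

section \<open>Infinitely many limit points\<close>

text \<open>Let \<open>e = K - j\<close> be a column far to the left that the left edge reaches. By periodicity, a time
  at which the cell in this column is nonzero can be moved back by multiples of \<open>P\<close> until it is below
  \<open>T + j * h + P\<close>. The left edge would then travel \<open>j\<close> columns in time about \<open>j * h\<close>, although its
  speed is bounded by \<open>q < 1 / h\<close>.\<close>

lemma periodic_window_contradicts_spreading:
  assumes ca: "cellular_automaton n F" and exp: "left_expansive n F h d w" and w: "w \<ge> 1"
    and spread: "left_spreading n F" and speed: "spreading_speed n F < 1 / ereal (real h)"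
    and x: "x \<in> number_like n" and P: "P > 0"
    and per: "\<And>t. t \<ge> T0 \<Longrightarrow> agree_on {K..<K + int w} ((F ^^ (t + P)) x) ((F ^^ t) x)"
  shows False
proof -
  let ?X = "\<lambda>t. (F ^^ t) x"
  have xc: "x \<in> configurations n" using x by (simp add: number_like_def)
  obtain q N where q: "q \<ge> 0" "q * real h < 1"
    and line: "\<And>t. t \<ge> N \<Longrightarrow> - q * real t \<le> real_of_int (left_edge (?X t))"
    by (rule left_edge_eventually_above_line[OF speed x]) blast
  define T where "T = max T0 N"
  \<comment> \<open>The line of slope \<open>-q\<close> at time \<open>T + j * h + P\<close> lies to the right of column \<open>K - j\<close>
    exactly when \<open>j > M\<close>.\<close>
  define M where "M = (real_of_int K + q * real (T + P)) / (1 - q * real h)"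
  obtain t where "left_edge ((F ^^ t) (?X N)) < K - \<lceil>\<bar>M\<bar>\<rceil>"
    using left_edge_unbounded[OF ca spread orbit_number_like[OF ca spread x]] by blast
  then have edge: "left_edge (?X (t + N)) < K - \<lceil>\<bar>M\<bar>\<rceil>" by (simp add: funpow_add)
  define e where "e = left_edge (?X (t + N))"
  define j where "j = nat (K - e)"
  have j: "e = K - int j" "real j > M"
  proof -
    have "real_of_int (K - e) > \<bar>M\<bar>"
      using edge unfolding e_def by linarith
    then show "e = K - int j" "real j > M"
      by (auto simp: j_def)
  qed
  have periodic: "?X (s + P) e = ?X s e" if "s \<ge> T + j * h" for s
    using periodicity_spreads_left[OF exp xc per, where t = s and j = j] that w j
    by (auto simp: T_def)
  \<comment> \<open>Moving back by \<open>P\<close> from a time \<open>\<ge> T + j * h + P\<close> leads to a time \<open>\<ge> T + j * h \<ge> N\<close>,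
    where the bound on the left edge is valid.\<close>
  have "\<exists>s. N \<le> s \<and> s < T + j * h + P \<and> ?X s e \<noteq> 0" if "s \<ge> N" "?X s e \<noteq> 0" for s
    using that
  proof (induction s rule: less_induct)
    case (less s)
    show ?case
    proof (cases "s < T + j * h + P")
      case False
      then have "s - P \<ge> T + j * h" "s - P < s" "s - P + P = s" using P by auto
      moreover have "s - P \<ge> N" using \<open>s - P \<ge> T + j * h\<close> by (simp add: T_def)
      ultimately show ?thesis
        using less periodic[of "s - P"] by metis
    qed (use less in blast)
  qed
  moreover have "?X (t + N) e \<noteq> 0"
    unfolding e_def by (rule left_edge_least(1)[OF orbit_number_like[OF ca spread x]])
  ultimately obtain s where s: "N \<le> s" "s < T + j * h + P" "?X s e \<noteq> 0"
    by (metis le_add2)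
  have "- q * real s \<le> real_of_int (left_edge (?X s))" using line[OF s(1)] .
  also have "\<dots> \<le> real_of_int e"
    using left_edge_least(2)[OF orbit_number_like[OF ca spread x] s(3)] by simp
  finally have "real j - real_of_int K \<le> q * real s" using j by simp
  also have "\<dots> \<le> q * real (T + j * h + P)"
    using s(2) q(1) by (intro mult_left_mono) (simp_all only: of_nat_le_iff less_imp_le)
  also have "\<dots> = q * real (T + P) + (q * real h) * real j" by (simp add: algebra_simps)
  finally have "real j * (1 - q * real h) \<le> real_of_int K + q * real (T + P)"
    by (simp add: algebra_simps)
  then have "real j \<le> M"
    using q(2) by (simp add: M_def pos_le_divide_eq)
  with j(2) show False by simp
qed

theorem theorem4p7:
  fixes n :: nat
    and F :: "(int \<Rightarrow> nat) \<Rightarrow> int \<Rightarrow> nat"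
    and x :: "int \<Rightarrow> nat"
  assumes "n \<ge> 1"
    and "cellular_automaton n F"
    and "rapidly_left_expansive n F"
    and "x \<in> number_like n"
  shows "infinite {y \<in> right_infinite_words n. limit_point (\<lambda>t. frac_conf ((F ^^ t) x)) y}"
proof
  assume fin: "finite {y \<in> right_infinite_words n. limit_point (\<lambda>t. frac_conf ((F ^^ t) x)) y}"
  obtain h d w where hdw: "w \<ge> 1" "left_expansive n F h d w" "left_spreading n F"
    "spreading_speed n F < 1 / ereal (real h)"
    using assms(3) unfolding rapidly_left_expansive_def by blast
  have xc: "x \<in> configurations n" using assms(4) by (simp add: number_like_def)
  have words: "frac_conf ((F ^^ t) x) \<in> right_infinite_words n" for t
    using orbit_in_configurations[OF assms(2) xc, of t] by (auto simp: frac_conf_def)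
  have "finite {y. limit_point (\<lambda>t. frac_conf ((F ^^ t) x)) y}"
    by (rule finite_subset[OF _ fin])
      (use limit_point_in_words[of "\<lambda>t. frac_conf ((F ^^ t) x)", OF words] in blast)
  then obtain K T P :: nat where "P > 0"
    "\<And>t. t \<ge> T \<Longrightarrow> agree_on {int K..<int K + int w} ((F ^^ (t + P)) x) ((F ^^ t) x)"
    by (rule orbit_window_eventually_periodic[OF assms(2) xc, of w]) blast
  then show False
    by (rule periodic_window_contradicts_spreading[OF assms(2) hdw(2,1,3,4) assms(4)])
qed

end
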